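(* Let $M$ be a finitely generated graded $S$-module. If $M_1,\ldots,M_d$ form an approximation system for $M$ of degree $t$, then \[\operatorname{Ass} M\subseteq\{\mathfrak m\}\cup\operatorname{Ass} M_1\cup\cdots\cup\operatorname{Ass} M_d.\]
   Context: $S=k[x_0,\ldots,x_n]$ is the standard graded polynomial ring over an infinite field $k$, and $\mathfrak m=(x_0,\ldots,x_n)$. All modules are finitely generated graded $S$-modules and morphisms are graded. $\operatorname{Ass} M$ is the set of associated primes of $M$. Approximation: a finitely generated graded module $M'$ is an approximation of $M$ if there is a surjective morphism $\phi:M\to M'$ with $\ker\phi$ annihilated by a proper homogeneous ideal of $S$. Approximation system: finitely generated graded modules $M_1,\dots,M_d$ form an approximation system for $M$ of degree $t$ if there are surjective morphisms $\phi_i:M\to M_i$ and proper homogeneous ideals $I_1,\dots,I_d$ of $S$ with $I_i\cdot\ker\phi_i=0$ for each $i$, and $\sum_i I_i\supseteq\mathfrak m^t$, where $t$ is an integer (necessarily $t\ge 1$, since the $I_i$ are proper). *)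

theory Defs
  imports "HOL-Library.Poly_Mapping" "HOL-Algebra.Ideal_Product" "HOL-Algebra.Module"
begin

text \<open>Polynomials are finitely supported coefficient functions on exponent vectors, with the
  convolution product of \<^theory>\<open>HOL-Library.Poly_Mapping\<close>; the carrier of
  \<open>mpoly_ring n\<close> is $k[x_0,\ldots,x_n]$, where $k$ is the field given by the type \<open>'k\<close>.\<close>

type_synonym 'k mpoly = "(nat \<Rightarrow>\<^sub>0 nat) \<Rightarrow>\<^sub>0 'k"

definition mpoly_ring :: "nat \<Rightarrow> 'k::field mpoly ring" where
  "mpoly_ring n = \<lparr>carrier = {p. \<forall>m\<in>Poly_Mapping.keys p. Poly_Mapping.keys m \<subseteq> {..n}},
     mult = (*), one = 1, zero = 0, add = (+)\<rparr>"

definition mpoly_var :: "nat \<Rightarrow> 'k::field mpoly" where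
  "mpoly_var i = Poly_Mapping.single (Poly_Mapping.single i 1) 1"

definition monom_degree :: "(nat \<Rightarrow>\<^sub>0 nat) \<Rightarrow> nat" where
  "monom_degree m = (\<Sum>i\<in>Poly_Mapping.keys m. Poly_Mapping.lookup m i)"

definition mpoly_grade :: "nat \<Rightarrow> nat \<Rightarrow> 'k::field mpoly set" where
  "mpoly_grade n j = {p \<in> carrier (mpoly_ring n). \<forall>m\<in>Poly_Mapping.keys p. monom_degree m = j}"

lemma mpoly_ring_cring: "cring (mpoly_ring n :: 'k::field mpoly ring)"
proof (rule cringI)
  let ?S = "mpoly_ring n :: 'k mpoly ring"
  show "abelian_group ?S"
  proof (rule abelian_groupI)
    fix p q assume "p \<in> carrier ?S" "q \<in> carrier ?S"
    then show "p \<oplus>\<^bsub>?S\<^esub> q \<in> carrier ?S"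
      using Poly_Mapping.keys_add[of p q] by (simp add: mpoly_ring_def) blast
  next
    fix p assume "p \<in> carrier ?S"
    then show "\<exists>q\<in>carrier ?S. q \<oplus>\<^bsub>?S\<^esub> p = \<zero>\<^bsub>?S\<^esub>"
      by (intro bexI[of _ "- p"]) (auto simp: mpoly_ring_def)
  qed (simp_all add: mpoly_ring_def ac_simps)
  show "Group.comm_monoid ?S"
  proof (rule comm_monoidI)
    fix p q assume pq: "p \<in> carrier ?S" "q \<in> carrier ?S"
    have "Poly_Mapping.keys m \<subseteq> {..n}" if m: "m \<in> Poly_Mapping.keys (p * q)" for m
    proof -
      obtain a b where "m = a + b" "a \<in> Poly_Mapping.keys p" "b \<in> Poly_Mapping.keys q"
        using keys_mult[of p q] m by blast
      then show ?thesis
        using pq Poly_Mapping.keys_add[of a b] by (simp add: mpoly_ring_def) blast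
    qed
    then show "p \<otimes>\<^bsub>?S\<^esub> q \<in> carrier ?S"
      by (simp add: mpoly_ring_def)
  qed (simp_all add: mpoly_ring_def ac_simps)
qed (simp add: mpoly_ring_def distrib_right)

definition irrelevant_ideal :: "nat \<Rightarrow> 'k::field mpoly set" where
  "irrelevant_ideal n = genideal (mpoly_ring n) (mpoly_var ` {..n})"

definition proper_homogeneous_ideal :: "nat \<Rightarrow> 'k::field mpoly set \<Rightarrow> bool" where
  "proper_homogeneous_ideal n I \<longleftrightarrow>
     ideal I (mpoly_ring n) \<and> I \<noteq> carrier (mpoly_ring n) \<and>
     (\<exists>X. X \<subseteq> (\<Union>j. mpoly_grade n j) \<and> I = genideal (mpoly_ring n) X)"

text \<open>\<open>grade M e\<close> is the homogeneous part of \<open>M\<close> of degree \<open>e\<close>. The inherited fields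
  \<open>mult\<close> and \<open>one\<close> of a module record carry no meaning.\<close>

record ('a, 'b) gmodule = "('a, 'b) module" +
  grade :: "int \<Rightarrow> 'b set"

locale graded_module = module "mpoly_ring n :: 'k::field mpoly ring" M
  for n :: nat and M :: "('k::field mpoly, 'm) gmodule" +
  assumes grade_additive_subgroup: "additive_subgroup (grade M e) M"
    and grade_decomposition:
      "x \<in> carrier M \<Longrightarrow>
        \<exists>!c. (\<forall>e. c e \<in> grade M e) \<and> finite {e. c e \<noteq> \<zero>\<^bsub>M\<^esub>} \<and>
             x = (\<Oplus>\<^bsub>M\<^esub>e\<in>{e. c e \<noteq> \<zero>\<^bsub>M\<^esub>}. c e)"
    and grade_smult:
      "a \<in> mpoly_grade n j \<Longrightarrow> x \<in> grade M e \<Longrightarrow> a \<odot>\<^bsub>M\<^esub> x \<in> grade M (int j + e)"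

definition fg_graded_module :: "nat \<Rightarrow> ('k::field mpoly, 'm) gmodule \<Rightarrow> bool" where
  "fg_graded_module n M \<longleftrightarrow> graded_module n M \<and>
     (\<exists>X. finite X \<and> X \<subseteq> carrier M \<and>
       (\<forall>y\<in>carrier M. \<exists>c \<in> X \<rightarrow> carrier (mpoly_ring n). y = (\<Oplus>\<^bsub>M\<^esub>x\<in>X. c x \<odot>\<^bsub>M\<^esub> x)))"

definition graded_hom ::
  "nat \<Rightarrow> ('k::field mpoly, 'm) gmodule \<Rightarrow> ('k mpoly, 'l) gmodule \<Rightarrow> ('m \<Rightarrow> 'l) set" where
  "graded_hom n M N = {\<phi> \<in> hom (add_monoid M) (add_monoid N).
     (\<forall>a\<in>carrier (mpoly_ring n). \<forall>x\<in>carrier M. \<phi> (a \<odot>\<^bsub>M\<^esub> x) = a \<odot>\<^bsub>N\<^esub> \<phi> x) \<and>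
     (\<forall>e. \<phi> ` grade M e \<subseteq> grade N e)}"

definition associated_primes :: "nat \<Rightarrow> ('k::field mpoly, 'm) gmodule \<Rightarrow> 'k mpoly set set" where
  "associated_primes n M = {P. primeideal P (mpoly_ring n) \<and>
     (\<exists>x\<in>carrier M. P = {a \<in> carrier (mpoly_ring n). a \<odot>\<^bsub>M\<^esub> x = \<zero>\<^bsub>M\<^esub>})}"

text \<open>Sums and powers of ideals are taken in the semiring \<^const>\<open>ideals_set\<close> of ideals. The
  modules \<open>N 1, \<dots>, N d\<close> share one carrier type, which is no loss of generality since finitely
  many types embed into their sum.\<close>

definition approximation_system ::
  "nat \<Rightarrow> ('k::field mpoly, 'm) gmodule \<Rightarrow> nat \<Rightarrow> (nat \<Rightarrow> ('k mpoly, 'l) gmodule) \<Rightarrow> nat \<Rightarrow> bool"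
  where
  "approximation_system n M d N t \<longleftrightarrow>
     (\<forall>i\<in>{1..d}. fg_graded_module n (N i)) \<and>
     (\<exists>\<phi> I.
       (\<forall>i\<in>{1..d}.
          \<phi> i \<in> graded_hom n M (N i) \<and> \<phi> i ` carrier M = carrier (N i) \<and>
          proper_homogeneous_ideal n (I i) \<and>
          (\<forall>a\<in>I i. \<forall>x\<in>a_kernel M (N i) (\<phi> i). a \<odot>\<^bsub>M\<^esub> x = \<zero>\<^bsub>M\<^esub>)) \<and>
       irrelevant_ideal n [^]\<^bsub>ideals_set (mpoly_ring n)\<^esub> t
         \<subseteq> (\<Oplus>\<^bsub>ideals_set (mpoly_ring n)\<^esub>i\<in>{1..d}. I i))"

end

theory Submission
  imports Defs
begin

text \<open>Let \<open>P = Ann x\<close> be an associated prime of \<open>M\<close>. If some ideal \<open>I i\<close> is not contained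
  in \<open>P\<close>, then passing to the image of \<open>x\<close> under \<open>\<phi> i\<close> does not change the annihilator: from
  \<open>a x \<in> ker (\<phi> i)\<close> it follows that \<open>I i a x = 0\<close>, that is, \<open>I i a \<subseteq> P\<close>, and hence \<open>a \<in> P\<close> by
  primality (\<open>annihilator_image_eq\<close>). So \<open>P\<close> is associated to \<open>N i\<close>.

  Otherwise \<open>P\<close> contains every \<open>I i\<close>, hence their sum, hence a power of the irrelevant ideal, and
  being prime it contains the irrelevant ideal itself. Modulo the irrelevant ideal, every
  polynomial is congruent to its constant term, which is zero or a unit, so the irrelevant ideal
  is maximal (\<open>irrelevant_ideal_maximal\<close>) and equal to \<open>P\<close>.\<close>

section \<open>Sums and powers in the semiring of ideals\<close>

lemma (in cring) ideals_set_finsum_subset: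
  assumes "finite A" and "ideal P R"
    and "\<And>i. i \<in> A \<Longrightarrow> ideal (I i) R" and "\<And>i. i \<in> A \<Longrightarrow> I i \<subseteq> P"
  shows "(\<Oplus>\<^bsub>ideals_set R\<^esub>i\<in>A. I i) \<subseteq> P"
proof -
  interpret Id: semiring "ideals_set R"
    by (rule ideals_set_is_semiring)
  interpret P: ideal P R
    by (rule assms(2))
  show ?thesis
    using assms(1,3,4)
  proof (induction A rule: finite_induct)
    case empty
    show ?case
      unfolding Id.finsum_empty using P.zero_closed by (simp add: ideals_set_def)
  next
    case (insert i A)
    have "(\<Oplus>\<^bsub>ideals_set R\<^esub>j\<in>insert i A. I j) = I i <+> (\<Oplus>\<^bsub>ideals_set R\<^esub>j\<in>A. I j)"
      using insert.hyps insert.prems(1)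
      by (subst Id.finsum_insert) (auto simp: ideals_set_def)
    also have "\<dots> \<subseteq> P"
      using insert.IH insert.prems
        by (auto simp: set_add_def' subset_iff
            intro!: additive_subgroup.a_closed[OF P.additive_subgroup_axioms])
    finally show ?case .
  qed
qed

text \<open>The power \<open>J [^] 0\<close> is the whole ring, so for \<open>t = 0\<close> the inclusion is immediate; each
  further factor \<open>J\<close> is split off by primality.\<close>

lemma (in primeideal) subset_if_ideals_set_pow_subset:
  assumes J: "ideal J R" and "J [^]\<^bsub>ideals_set R\<^esub> (t::nat) \<subseteq> I"
  shows "J \<subseteq> I"
proof -
  interpret Id: semiring "ideals_set R"
    by (rule ideals_set_is_semiring)
  have J': "J \<in> carrier (ideals_set R)"
    using J by (simp add: ideals_set_def)
  show ?thesis
    using assms(2)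
  proof (induction t)
    case 0
    then show ?case
      using additive_subgroup.a_subset[OF ideal.axioms(1)[OF J]] by (simp add: ideals_set_def)
  next
    case (Suc t)
    have "ideal (J [^]\<^bsub>ideals_set R\<^esub> t) R"
      using Id.nat_pow_closed[OF J'] by (simp add: ideals_set_def)
    moreover have "(J [^]\<^bsub>ideals_set R\<^esub> t) \<cdot> J \<subseteq> I"
      using Suc.prems by (simp add: ideals_set_def)
    ultimately show ?case
      using primeideal_divides_ideal_prod[OF primeideal_axioms _ J] Suc.IH by blast
  qed
qed

section \<open>Maximality of the irrelevant ideal\<close>

lemma irrelevant_ideal_is_ideal:
  "ideal (irrelevant_ideal n) (mpoly_ring n :: 'k::field mpoly ring)"
  unfolding irrelevant_ideal_def
  by (intro ring.genideal_ideal[OF cring.axioms(1)[OF mpoly_ring_cring]])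
    (auto simp: mpoly_ring_def mpoly_var_def)

lemma monom_in_ideal_if_vars_in_ideal:
  assumes Q: "ideal Q (mpoly_ring n :: 'k::field mpoly ring)"
    and vars: "mpoly_var ` {..n} \<subseteq> Q"
    and m: "m \<noteq> 0" "Poly_Mapping.keys m \<subseteq> {..n}"
  shows "Poly_Mapping.single m c \<in> Q"
proof -
  obtain i where i: "i \<in> Poly_Mapping.keys m"
    using m(1) by fastforce
  define m' where "m' = m - Poly_Mapping.single i 1"
  have split: "m = Poly_Mapping.single i 1 + m'"
    using i unfolding m'_def
    by (intro poly_mapping_eqI) (auto simp: lookup_add lookup_minus lookup_single when_def in_keys_iff)
  then have "Poly_Mapping.keys m' \<subseteq> {..n}"
    using m(2) by (auto simp: in_keys_iff lookup_add subset_iff)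
  then have "Poly_Mapping.single m' c \<in> carrier (mpoly_ring n)"
    by (auto simp: mpoly_ring_def)
  moreover have "mpoly_var i \<in> Q"
    using i m(2) vars by blast
  ultimately have "mpoly_var i * Poly_Mapping.single m' c \<in> Q"
    using ideal.I_r_closed[OF Q] by (simp add: mpoly_ring_def)
  then show ?thesis
    using split by (simp add: mpoly_var_def mult_single)
qed

text \<open>Such a polynomial is a sum of monomials of positive degree, and each of these is divisible
  by a variable. The induction adds one monomial at a time.\<close>

lemma no_const_term_in_irrelevant_ideal:
  fixes p :: "'k::field mpoly"
  assumes "p \<in> carrier (mpoly_ring n)" and "Poly_Mapping.lookup p 0 = 0"
  shows "p \<in> irrelevant_ideal n"
proof -
  interpret S: cring "mpoly_ring n :: 'k mpoly ring"
    by (rule mpoly_ring_cring)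
  have vars_carrier: "(mpoly_var ` {..n} :: 'k mpoly set) \<subseteq> carrier (mpoly_ring n)"
    by (auto simp: mpoly_ring_def mpoly_var_def)
  interpret J: ideal "irrelevant_ideal n" "mpoly_ring n :: 'k mpoly ring"
    by (rule irrelevant_ideal_is_ideal)
  have vars: "(mpoly_var ` {..n} :: 'k mpoly set) \<subseteq> irrelevant_ideal n"
    unfolding irrelevant_ideal_def by (rule S.genideal_self[OF vars_carrier])
  show ?thesis
    using assms
  proof (induction p rule: update_induct)
    case const
    then show ?case
      using J.zero_closed by (simp add: mpoly_ring_def)
  next
    case (update p m c)
    have sum: "Poly_Mapping.update m c p = p + Poly_Mapping.single m c"
      using update.hyps
      by (intro poly_mapping_eqI) (auto simp: lookup_update lookup_add lookup_single in_keys_iff)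
    have "m \<noteq> 0"
      using update by (auto simp: lookup_update)
    moreover have keys: "Poly_Mapping.keys m \<subseteq> {..n}" and p: "p \<in> carrier (mpoly_ring n)"
      using update by (auto simp: mpoly_ring_def keys_update)
    ultimately have "Poly_Mapping.single m c \<in> irrelevant_ideal n"
      using monom_in_ideal_if_vars_in_ideal[OF irrelevant_ideal_is_ideal vars] by blast
    moreover have "p \<in> irrelevant_ideal n"
      using update \<open>m \<noteq> 0\<close> p by (simp add: lookup_update)
    ultimately show ?case
      using additive_subgroup.a_closed[OF J.additive_subgroup_axioms]
      unfolding sum by (simp add: mpoly_ring_def)
  qed
qed

lemma irrelevant_ideal_maximal:
  fixes P :: "'k::field mpoly set"
  assumes P: "ideal P (mpoly_ring n)" and proper: "P \<noteq> carrier (mpoly_ring n)"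
    and sub: "irrelevant_ideal n \<subseteq> P"
  shows "P = irrelevant_ideal n"
proof
  interpret P: ideal P "mpoly_ring n :: 'k mpoly ring"
    by (rule P)
  show "P \<subseteq> irrelevant_ideal n"
  proof
    fix p assume p: "p \<in> P"
    define c where "c = Poly_Mapping.lookup p 0"
    define q where "q = Poly_Mapping.single 0 (- c) + p"
    have const: "Poly_Mapping.single 0 b \<in> carrier (mpoly_ring n)" for b :: 'k
      by (simp add: mpoly_ring_def)
    have "q \<in> carrier (mpoly_ring n)"
      using P.add.m_closed[OF const P.Icarr[OF p]] by (simp add: q_def mpoly_ring_def)
    moreover have "Poly_Mapping.lookup q 0 = 0"
      by (simp add: q_def c_def lookup_add)
    ultimately have q: "q \<in> irrelevant_ideal n"
      by (rule no_const_term_in_irrelevant_ideal)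
    \<comment> \<open>\<open>P\<close> contains both \<open>p\<close> and \<open>q\<close>, hence their difference, the constant \<open>c\<close>; if \<open>c\<close> were
      nonzero, scaling by \<open>inverse c\<close> would put \<open>1\<close> into \<open>P\<close>.\<close>
    have "c = 0"
    proof (rule ccontr)
      assume "c \<noteq> 0"
      have "Poly_Mapping.single 0 (- inverse c) * q \<in> P"
        using P.I_l_closed[OF _ const] q sub by (auto simp: mpoly_ring_def)
      moreover have "Poly_Mapping.single 0 (inverse c) * p \<in> P"
        using P.I_l_closed[OF p const] by (simp add: mpoly_ring_def)
      ultimately have
        "Poly_Mapping.single 0 (- inverse c) * q + Poly_Mapping.single 0 (inverse c) * p \<in> P"
        using additive_subgroup.a_closed[OF P.additive_subgroup_axioms] by (simp add: mpoly_ring_def)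
      moreover have
        "Poly_Mapping.single 0 (- inverse c) * q + Poly_Mapping.single 0 (inverse c) * p = 1"
        using \<open>c \<noteq> 0\<close> by (simp add: q_def right_diff_distrib mult_single single_uminus)
      ultimately show False
        using P.one_imp_carrier proper by (simp add: mpoly_ring_def)
    qed
    then show "p \<in> irrelevant_ideal n"
      using q by (simp add: q_def)
  qed
qed (rule sub)

section \<open>Annihilators under module homomorphisms\<close>

text \<open>If \<open>a\<close> annihilates \<open>f x\<close>, then \<open>a x\<close> lies in the kernel, so \<open>I\<close> annihilates it.
  Multiplying \<open>a\<close> by an element of \<open>I\<close> outside \<open>P\<close> therefore gives an element of \<open>P\<close>, and
  primality removes the extra factor.\<close>

lemma annihilator_image_eq:
  assumes M: "module R M" and P: "primeideal P R"
    and x: "x \<in> carrier M" and ann: "P = {a \<in> carrier R. a \<odot>\<^bsub>M\<^esub> x = \<zero>\<^bsub>M\<^esub>}"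
    and zero: "f \<zero>\<^bsub>M\<^esub> = \<zero>\<^bsub>N\<^esub>"
    and linear: "\<And>a. a \<in> carrier R \<Longrightarrow> f (a \<odot>\<^bsub>M\<^esub> x) = a \<odot>\<^bsub>N\<^esub> f x"
    and I: "I \<subseteq> carrier R" "\<not> I \<subseteq> P"
    and kernel: "\<And>a y. a \<in> I \<Longrightarrow> y \<in> a_kernel M N f \<Longrightarrow> a \<odot>\<^bsub>M\<^esub> y = \<zero>\<^bsub>M\<^esub>"
  shows "P = {a \<in> carrier R. a \<odot>\<^bsub>N\<^esub> f x = \<zero>\<^bsub>N\<^esub>}"
proof -
  interpret M: module R M
    by (rule M)
  interpret P: primeideal P R
    by (rule P)
  obtain b where b: "b \<in> I" "b \<notin> P"
    using I(2) by blast
  have contracts: "a \<in> P" if a: "a \<in> carrier R" "a \<odot>\<^bsub>N\<^esub> f x = \<zero>\<^bsub>N\<^esub>" for a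
  proof -
    have "a \<odot>\<^bsub>M\<^esub> x \<in> a_kernel M N f"
      using a x linear by (simp add: a_kernel_def')
    then have "b \<odot>\<^bsub>M\<^esub> (a \<odot>\<^bsub>M\<^esub> x) = \<zero>\<^bsub>M\<^esub>"
      using b(1) kernel by blast
    moreover have b_carrier: "b \<in> carrier R"
      using b(1) I(1) by blast
    ultimately have "b \<otimes>\<^bsub>R\<^esub> a \<in> P"
      unfolding ann using M.smult_assoc1[OF b_carrier a(1) x] a(1) by simp
    then show ?thesis
      using P.I_prime[OF b_carrier a(1)] b(2) by blast
  qed
  have extends: "a \<odot>\<^bsub>N\<^esub> f x = \<zero>\<^bsub>N\<^esub>" if "a \<in> P" for a
  proof -
    have "a \<in> carrier R" and "a \<odot>\<^bsub>M\<^esub> x = \<zero>\<^bsub>M\<^esub>"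
      using that unfolding ann by blast+
    then show ?thesis
      using linear[of a] zero by metis
  qed
  show ?thesis
    by (intro equalityI subsetI CollectI conjI) (auto intro: contracts extends P.Icarr)
qed

section \<open>Associated primes of an approximation system\<close>

theorem proposition3p2:
  fixes n d t :: nat
    and M :: "('k::field mpoly, 'm) gmodule"
    and N :: "nat \<Rightarrow> ('k mpoly, 'l) gmodule"
  assumes "infinite (UNIV :: 'k set)"
    and "fg_graded_module n M"
    and "approximation_system n M d N t"
  shows "associated_primes n M \<subseteq> {irrelevant_ideal n} \<union> (\<Union>i\<in>{1..d}. associated_primes n (N i))"
proof
  let ?S = "mpoly_ring n :: 'k mpoly ring"
  interpret M: graded_module n M
    using assms(2) by (simp add: fg_graded_module_def)
  have N_module: "module ?S (N i)" if "i \<in> {1..d}" for i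
    using assms(3) that
    by (simp add: approximation_system_def fg_graded_module_def graded_module_def)
  obtain \<phi> I where system: "\<forall>i\<in>{1..d}. \<phi> i \<in> graded_hom n M (N i) \<and>
      \<phi> i ` carrier M = carrier (N i) \<and> proper_homogeneous_ideal n (I i) \<and>
      (\<forall>a\<in>I i. \<forall>x\<in>a_kernel M (N i) (\<phi> i). a \<odot>\<^bsub>M\<^esub> x = \<zero>\<^bsub>M\<^esub>)"
    and power: "irrelevant_ideal n [^]\<^bsub>ideals_set ?S\<^esub> t \<subseteq> (\<Oplus>\<^bsub>ideals_set ?S\<^esub>i\<in>{1..d}. I i)"
    using assms(3) unfolding approximation_system_def by (elim conjE exE)
  have I: "ideal (I i) ?S" if "i \<in> {1..d}" for i
    using system that by (simp add: proper_homogeneous_ideal_def)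
  fix P assume "P \<in> associated_primes n M"
  then obtain x where P: "primeideal P ?S" and x: "x \<in> carrier M"
    and ann: "P = {a \<in> carrier ?S. a \<odot>\<^bsub>M\<^esub> x = \<zero>\<^bsub>M\<^esub>}"
    unfolding associated_primes_def by blast
  interpret P: primeideal P ?S
    by (rule P)
  show "P \<in> {irrelevant_ideal n} \<union> (\<Union>i\<in>{1..d}. associated_primes n (N i))"
  proof (cases "\<exists>i\<in>{1..d}. \<not> I i \<subseteq> P")
    case True
    then obtain i where i: "i \<in> {1..d}" and not_sub: "\<not> I i \<subseteq> P"
      by blast
    have hom: "\<phi> i \<in> graded_hom n M (N i)"
      and surj: "\<phi> i ` carrier M = carrier (N i)"
      and kernel: "\<And>a y. a \<in> I i \<Longrightarrow> y \<in> a_kernel M (N i) (\<phi> i) \<Longrightarrow> a \<odot>\<^bsub>M\<^esub> y = \<zero>\<^bsub>M\<^esub>"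
      using system i by simp_all
    interpret N: module ?S "N i"
      by (rule N_module[OF i])
    have "\<phi> i \<zero>\<^bsub>M\<^esub> = \<zero>\<^bsub>N i\<^esub>"
      using hom group_hom.hom_one[of "add_monoid M" "add_monoid (N i)" "\<phi> i"]
      by (simp add: graded_hom_def group_hom_def group_hom_axioms_def M.M.a_group N.M.a_group)
    moreover have "\<phi> i (a \<odot>\<^bsub>M\<^esub> x) = a \<odot>\<^bsub>N i\<^esub> \<phi> i x" if "a \<in> carrier ?S" for a
      using hom that x by (simp add: graded_hom_def)
    ultimately have "P = {a \<in> carrier ?S. a \<odot>\<^bsub>N i\<^esub> \<phi> i x = \<zero>\<^bsub>N i\<^esub>}"
      using ideal.Icarr[OF I[OF i]]
      by (intro annihilator_image_eq[OF M.module_axioms P x ann _ _ _ not_sub kernel]) auto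
    moreover have "\<phi> i x \<in> carrier (N i)"
      using surj x by blast
    ultimately have "P \<in> associated_primes n (N i)"
      using P unfolding associated_primes_def by blast
    then show ?thesis
      using i by blast
  next
    case False
    then have "(\<Oplus>\<^bsub>ideals_set ?S\<^esub>i\<in>{1..d}. I i) \<subseteq> P"
      using I by (intro cring.ideals_set_finsum_subset[OF mpoly_ring_cring])
        (auto intro: P.ideal_axioms)
    then have "irrelevant_ideal n \<subseteq> P"
      using primeideal.subset_if_ideals_set_pow_subset[OF P irrelevant_ideal_is_ideal
          order_trans[OF power]] by blast
    then have "P = irrelevant_ideal n"
      using P.I_notcarr by (intro irrelevant_ideal_maximal[OF P.ideal_axioms]) simp_all
    then show ?thesis
      by blast
  qed
qed

end
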